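(* Let $g(3,\mathbb{C})$ be the $8$-dimensional Clifford algebra over $\mathbb{C}$ generated by $e_1,e_2,e_3$ with $e_pe_q=-e_qe_p$ for $p\neq q$ and $e_p^2=-1$, with basis $1,\ e_1,\ e_2,\ e_3,\ i=e_1e_2,\ j=e_1e_3,\ k=e_2e_3,\ z=e_1e_2e_3$. For each $w\in\mathbb{C}$ let $\sqrt{w}$ denote a fixed choice of complex square root of $w$. Then the $7$-dimensional subalgebras of $g(3,\mathbb{C})$ over the field $\mathbb{C}$ of complex numbers are exactly the members of the following four one-parameter sets ($a\in\mathbb{C}$): $$h_1=\mathrm{Span}\{1,\ e_1+k,\ e_2+ak,\ e_3+\sqrt{-1-a^2}\,k,\ i-\sqrt{-1-a^2}\,k,\ j+ak,\ z\},$$ $$h_2=\mathrm{Span}\{1,\ e_1+k,\ e_2+ak,\ e_3-\sqrt{-1-a^2}\,k,\ i+\sqrt{-1-a^2}\,k,\ j+ak,\ z\},$$ $$h_3=\mathrm{Span}\{1,\ e_1-k,\ e_2+ak,\ e_3+\sqrt{-1-a^2}\,k,\ i+\sqrt{-1-a^2}\,k,\ j-ak,\ z\},$$ $$h_4=\mathrm{Span}\{1,\ e_1-k,\ e_2+ak,\ e_3-\sqrt{-1-a^2}\,k,\ i-\sqrt{-1-a^2}\,k,\ j-ak,\ z\},$$ together with the four isolated subalgebras $$h_5=\mathrm{Span}\{1,\ e_1,\ e_2+j,\ e_3+\sqrt{-1}\,j,\ i+\sqrt{-1}\,j,\ k,\ z\},$$ $$h_6=\mathrm{Span}\{1,\ e_1,\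 e_2+j,\ e_3-\sqrt{-1}\,j,\ i-\sqrt{-1}\,j,\ k,\ z\},$$ $$h_7=\mathrm{Span}\{1,\ e_1,\ e_2-j,\ e_3+\sqrt{-1}\,j,\ i-\sqrt{-1}\,j,\ k,\ z\},$$ $$h_8=\mathrm{Span}\{1,\ e_1,\ e_2-j,\ e_3-\sqrt{-1}\,j,\ i+\sqrt{-1}\,j,\ k,\ z\}.$$ That is, each of these $\mathbb{C}$-linear spans is a $7$-dimensional subalgebra, and every $7$-dimensional subalgebra of $g(3,\mathbb{C})$ over $\mathbb{C}$ equals one of them. Moreover, the Clifford algebra $g(3,\mathbb{C})$ has no $7$-dimensional subalgebras over the field of real numbers.
   Context: $g(n,\mathbb{C})$ denotes the associative unital $\mathbb{C}$-algebra generated by $e_1,\dots,e_n$ subject to $e_pe_q=-e_qe_p$ for $p\ne q$ and $e_p^2=-1$; it has dimension $2^n$ over $\mathbb{C}$, with basis the products $e_{p_1}\cdots e_{p_m}$, $p_1<\dots<p_m$ (the empty product being the identity $1$). Here $i,j,k,z$ denote the elements $e_1e_2,\ e_1e_3,\ e_2e_3,\ e_1e_2e_3$ of the algebra ($i$ is not the imaginary unit; the imaginary unit is written $\sqrt{-1}$). A subalgebra over a field $F\in\{\mathbb{R},\mathbb{C}\}$ is an $F$-linear subspace $h$ such that $xy\in h$ for all $x,y\in h$ (it is not required a priori to contain $1$), and its dimension is taken over $F$. $\mathrm{Span}$ means $\mathbb{C}$-linear span.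
   Formalization: The last sentence is proved only for real subalgebras contained in the real span of 1, e_1, e_2, e_3, i, j, k, z; for arbitrary real subspaces of g(3,C) it is false (quaternions plus upper triangular real 2x2 matrices give real dimension 7). *)

theory Defs
  imports Complex_Main "HOL-Library.Poly_Mapping" "HOL-Library.Numeral_Type"
begin

section \<open>The free associative algebra\<close>

datatype 'n word = Word (letters: "'n list")

instantiation word :: (type) monoid_add
begin
definition zero_word :: "'a word" where "0 = Word []"
definition plus_word :: "'a word \<Rightarrow> 'a word \<Rightarrow> 'a word"
  where "v + w = Word (letters v @ letters w)"
instance by standard (simp_all add: zero_word_def plus_word_def)
end

text \<open>Since concatenation of words is written additively, the convolution product on
  finitely supported functions on words is the product of noncommutative polynomials.\<close>

type_synonym 'n free_alg = "'n word \<Rightarrow>\<^sub>0 complex"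

definition free_gen :: "'n \<Rightarrow> 'n free_alg"
  where "free_gen p = Poly_Mapping.single (Word [p]) 1"

definition free_const :: "complex \<Rightarrow> 'n free_alg"
  where "free_const c = Poly_Mapping.single 0 c"

lemma free_const_commute: "free_const c * x = x * free_const c"
proof (induction x rule: update_induct)
  case (update f w b)
  have "Poly_Mapping.update w b f = f + Poly_Mapping.single w b"
    using update(1) by (intro poly_mapping_eqI)
      (auto simp: lookup_update lookup_add lookup_single in_keys_iff when_def)
  then show ?case
    using update(3) by (simp add: free_const_def mult_single algebra_simps)
qed simp

lemma free_const_simps:
  "free_const 1 = 1" "free_const (a + b) = free_const a + free_const b"
  "free_const (a * b) = free_const a * free_const b"
  by (simp_all add: free_const_def single_add mult_single)

section \<open>The complex Clifford algebra\<close>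

text \<open>The generators are indexed by the type \<open>'n\<close>: \<open>g(n,\<complex>)\<close> is \<open>'n clifford\<close> for an index
  type with \<open>n\<close> elements; for \<open>g(3,\<complex>)\<close> the numeral type \<open>3\<close> is used, whose elements are
  \<open>1\<close>, \<open>2\<close> and \<open>3 = 0\<close>. The defining relations are imposed by dividing the free algebra
  by the two-sided ideal which they generate.\<close>

inductive_set clifford_ideal :: "'n free_alg set" where
  anticommute: "p \<noteq> q \<Longrightarrow> free_gen p * free_gen q + free_gen q * free_gen p \<in> clifford_ideal"
| square: "free_gen p * free_gen p + 1 \<in> clifford_ideal"
| zero: "0 \<in> clifford_ideal"
| add: "x \<in> clifford_ideal \<Longrightarrow> y \<in> clifford_ideal \<Longrightarrow> x + y \<in> clifford_ideal"
| mult_left: "x \<in> clifford_ideal \<Longrightarrow> a * x \<in> clifford_ideal"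
| mult_right: "x \<in> clifford_ideal \<Longrightarrow> x * a \<in> clifford_ideal"

lemma clifford_ideal_uminus: "x \<in> clifford_ideal \<Longrightarrow> - x \<in> clifford_ideal"
  using clifford_ideal.mult_left[of x "- 1"] by simp

definition clifford_rel :: "'n free_alg \<Rightarrow> 'n free_alg \<Rightarrow> bool"
  where "clifford_rel x y \<longleftrightarrow> x - y \<in> clifford_ideal"

lemma equivp_clifford_rel: "equivp (clifford_rel :: 'n free_alg \<Rightarrow> 'n free_alg \<Rightarrow> bool)"
proof (rule equivpI)
  show "reflp (clifford_rel :: 'n free_alg \<Rightarrow> _)"
    by (simp add: reflp_def clifford_rel_def clifford_ideal.zero)
  show "symp (clifford_rel :: 'n free_alg \<Rightarrow> _)"
    using clifford_ideal_uminus by (fastforce simp: symp_def clifford_rel_def)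
  show "transp (clifford_rel :: 'n free_alg \<Rightarrow> _)"
  proof (rule transpI)
    fix x y z :: "'n free_alg"
    assume "clifford_rel x y" "clifford_rel y z"
    then have "(x - y) + (y - z) \<in> clifford_ideal"
      unfolding clifford_rel_def by (rule clifford_ideal.add)
    then show "clifford_rel x z" by (simp add: clifford_rel_def)
  qed
qed

quotient_type 'n clifford = "'n free_alg" / clifford_rel
  by (rule equivp_clifford_rel)

lemma clifford_rel_mult:
  assumes "clifford_rel x x'" "clifford_rel y y'"
  shows "clifford_rel (x * y) (x' * y')"
proof -
  have "x * y - x' * y' = (x - x') * y + x' * (y - y')"
    by (simp add: algebra_simps)
  then show ?thesis
    using assms by (simp add: clifford_rel_def clifford_ideal.intros(4-6))
qed

instantiation clifford :: (type) "{ring, monoid_mult}"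
begin
lift_definition zero_clifford :: "'a clifford" is 0 .
lift_definition one_clifford :: "'a clifford" is 1 .
lift_definition plus_clifford :: "'a clifford \<Rightarrow> 'a clifford \<Rightarrow> 'a clifford" is "(+)"
  unfolding clifford_rel_def by (metis add_diff_add clifford_ideal.add)
lift_definition uminus_clifford :: "'a clifford \<Rightarrow> 'a clifford" is uminus
  unfolding clifford_rel_def using clifford_ideal_uminus by fastforce
definition minus_clifford :: "'a clifford \<Rightarrow> 'a clifford \<Rightarrow> 'a clifford"
  where "minus_clifford x y = x + - y"
lift_definition times_clifford :: "'a clifford \<Rightarrow> 'a clifford \<Rightarrow> 'a clifford" is "(*)"
  by (rule clifford_rel_mult)
instance
proof
  fix a b c :: "'a clifford"
  note refl = equivp_reflp[OF equivp_clifford_rel]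
  show "a + b + c = a + (b + c)" by transfer (simp add: refl add.assoc)
  show "a + b = b + a" by transfer (simp add: refl add.commute)
  show "0 + a = a" by transfer (simp add: refl)
  show "- a + a = 0" by transfer (simp add: refl)
  show "a - b = a + - b" by (rule minus_clifford_def)
  show "a * b * c = a * (b * c)" by transfer (simp add: refl mult.assoc)
  show "(a + b) * c = a * c + b * c" by transfer (simp add: refl distrib_right)
  show "a * (b + c) = a * b + a * c" by transfer (simp add: refl distrib_left)
  show "1 * a = a" by transfer (simp add: refl)
  show "a * 1 = a" by transfer (simp add: refl)
qed
end

lift_definition clifford_gen :: "'n \<Rightarrow> 'n clifford" is free_gen .

lift_definition scaleC :: "complex \<Rightarrow> 'n clifford \<Rightarrow> 'n clifford" (infixr "*\<^sub>C" 75)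
  is "\<lambda>c x. free_const c * x"
  by (intro clifford_rel_mult equivp_reflp[OF equivp_clifford_rel])

lemma clifford_gen_anticommute:
  "p \<noteq> q \<Longrightarrow> clifford_gen p * clifford_gen q = - (clifford_gen q * clifford_gen p)"
  by transfer (simp add: clifford_rel_def clifford_ideal.anticommute)

lemma clifford_gen_square: "clifford_gen p * clifford_gen p = - 1"
  by transfer (simp add: clifford_rel_def clifford_ideal.square)

lemma scaleC_vector_space: "vector_space (scaleC :: complex \<Rightarrow> 'n clifford \<Rightarrow> 'n clifford)"
proof
  fix a b :: complex and x y :: "'n clifford"
  note refl = equivp_reflp[OF equivp_clifford_rel]
  show "a *\<^sub>C (x + y) = a *\<^sub>C x + a *\<^sub>C y" by transfer (simp add: refl distrib_left)
  show "(a + b) *\<^sub>C x = a *\<^sub>C x + b *\<^sub>C x"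
    by transfer (simp add: refl distrib_right free_const_simps)
  show "a *\<^sub>C b *\<^sub>C x = (a * b) *\<^sub>C x"
    by transfer (simp add: refl mult.assoc free_const_simps)
  show "1 *\<^sub>C x = x" by transfer (simp add: refl free_const_simps)
qed

lemma scaleC_mult_left: "(c *\<^sub>C x) * y = c *\<^sub>C (x * y)"
  by transfer (simp add: equivp_reflp[OF equivp_clifford_rel] mult.assoc)

lemma scaleC_mult_right: "x * (c *\<^sub>C y) = c *\<^sub>C (x * y)"
proof (transfer fixing: c)
  fix x y :: "'a free_alg"
  have "x * (free_const c * y) = free_const c * (x * y)"
    by (metis free_const_commute mult.assoc)
  then show "clifford_rel (x * (free_const c * y)) (free_const c * (x * y))"
    by (simp add: equivp_reflp[OF equivp_clifford_rel])
qed

instantiation clifford :: (type) real_algebra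
begin
definition scaleR_clifford :: "real \<Rightarrow> 'a clifford \<Rightarrow> 'a clifford"
  where "r *\<^sub>R x = complex_of_real r *\<^sub>C x"
instance
proof
  fix a b :: real and x y :: "'a clifford"
  interpret vector_space "scaleC :: complex \<Rightarrow> 'a clifford \<Rightarrow> 'a clifford"
    by (rule scaleC_vector_space)
  show "a *\<^sub>R (x + y) = a *\<^sub>R x + a *\<^sub>R y" by (simp add: scaleR_clifford_def scale_right_distrib)
  show "(a + b) *\<^sub>R x = a *\<^sub>R x + b *\<^sub>R x" by (simp add: scaleR_clifford_def scale_left_distrib)
  show "a *\<^sub>R b *\<^sub>R x = (a * b) *\<^sub>R x" by (simp add: scaleR_clifford_def)
  show "1 *\<^sub>R x = x" by (simp add: scaleR_clifford_def)
  show "a *\<^sub>R x * y = a *\<^sub>R (x * y)" by (simp add: scaleR_clifford_def scaleC_mult_left)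
  show "x * a *\<^sub>R y = a *\<^sub>R (x * y)" by (simp add: scaleR_clifford_def scaleC_mult_right)
qed
end

global_interpretation clifford_complex:
  vector_space "scaleC :: complex \<Rightarrow> 'n clifford \<Rightarrow> 'n clifford"
  defines cspan = clifford_complex.span
    and cdim = clifford_complex.dim
    and csubspace = clifford_complex.subspace
  by (rule scaleC_vector_space)

section \<open>Subalgebras\<close>

text \<open>A subalgebra need not contain \<open>1\<close>.\<close>

definition complex_subalgebra :: "'n clifford set \<Rightarrow> bool"
  where "complex_subalgebra h \<longleftrightarrow> csubspace h \<and> (\<forall>x\<in>h. \<forall>y\<in>h. x * y \<in> h)"

text \<open>The algebra over \<open>\<real>\<close> with the \<open>2^n\<close> basis products as its basis is the real span of these
  products inside \<open>g(n,\<complex>)\<close>; a subalgebra of \<open>g(n,\<complex>)\<close> over the field of real numbers is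
  understood as a real subalgebra contained in that real span. Without this containment
  \<open>g(3,\<complex>)\<close> would be a real algebra of dimension \<open>16\<close>, which does have real subalgebras of
  dimension \<open>7\<close>: with the idempotents \<open>p = (1 + z)/2\<close> and \<open>q = (1 - z)/2\<close>, the real span of
  \<open>p, pi, pj, pk, q, \<surd>(-1) qj, q(i + \<surd>(-1) k)\<close> is one.\<close>

definition real_subalgebra :: "'n clifford set \<Rightarrow> bool"
  where "real_subalgebra h \<longleftrightarrow> subspace h \<and> (\<forall>x\<in>h. \<forall>y\<in>h. x * y \<in> h)"

end

theory Submission
  imports Defs
begin

text \<open>A subspace of codimension one is the kernel of a functional \<open>\<phi>\<close>. If it is closed under
  multiplication, then \<open>\<phi> 1 = 0\<close>, since otherwise \<open>\<phi>\<close> would be proportional to a character; and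
  \<open>\<phi> z = 0\<close>, since otherwise \<open>\<phi>\<close> would be a trace. Multiplication by the central involution \<open>z\<close>
  preserves the kernel, so \<open>\<phi> (z x) = s \<phi> x\<close> with \<open>s\<^sup>2 = 1\<close>, and \<open>\<phi>\<close> is determined by \<open>s\<close> and the
  vector \<open>n = (\<phi> i, \<phi> j, \<phi> k)\<close>. Products of quaternions in the kernel show that \<open>n\<close> is isotropic.
  Conversely, every such \<open>\<phi>\<close> has a multiplicatively closed kernel. Over the reals no nonzero
  isotropic vector exists; over the complex numbers the listed spans are the kernels
  after scaling \<open>n\<close> to \<open>\<phi> k = 1\<close> or, if \<open>\<phi> k = 0\<close>, to \<open>\<phi> j = 1\<close>.\<close>

section \<open>The basis of the Clifford algebra\<close>

text \<open>This evaluates a noncommutative polynomial at the operators \<open>\<gamma> p\<close>.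
  Functions serve as column vectors, and \<open>foldr\<close> turns concatenation of words into
  composition of operators.\<close>

definition poly_action ::
    "('n \<Rightarrow> ('i \<Rightarrow> complex) \<Rightarrow> ('i \<Rightarrow> complex)) \<Rightarrow> 'n free_alg \<Rightarrow> ('i \<Rightarrow> complex) \<Rightarrow> ('i \<Rightarrow> complex)"
  where "poly_action \<gamma> f v b =
    (\<Sum>w\<in>Poly_Mapping.keys f. Poly_Mapping.lookup f w * foldr \<gamma> (letters w) v b)"

lemma poly_action_superset:
  assumes "finite A" "Poly_Mapping.keys f \<subseteq> A"
  shows "poly_action \<gamma> f v b = (\<Sum>w\<in>A. Poly_Mapping.lookup f w * foldr \<gamma> (letters w) v b)"
  unfolding poly_action_def using assms
  by (intro sum.mono_neutral_left) (auto simp: in_keys_iff)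

lemma poly_action_zero [simp]: "poly_action \<gamma> 0 v = (\<lambda>_. 0)"
  by (rule ext) (simp add: poly_action_def)

lemma poly_action_add: "poly_action \<gamma> (f + g) v = (\<lambda>b. poly_action \<gamma> f v b + poly_action \<gamma> g v b)"
proof
  fix b
  let ?A = "Poly_Mapping.keys f \<union> Poly_Mapping.keys g"
  have "finite ?A" "Poly_Mapping.keys (f + g) \<subseteq> ?A"
    using Poly_Mapping.keys_add[of f g] by auto
  then show "poly_action \<gamma> (f + g) v b = poly_action \<gamma> f v b + poly_action \<gamma> g v b"
    using poly_action_superset[of ?A f \<gamma> v b] poly_action_superset[of ?A g \<gamma> v b]
      poly_action_superset[of ?A "f + g" \<gamma> v b]
    by (simp add: lookup_add distrib_right sum.distrib)
qed

lemma poly_action_single: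
  "poly_action \<gamma> (Poly_Mapping.single w c) v = (\<lambda>b. c * foldr \<gamma> (letters w) v b)"
  by (rule ext) (cases "c = 0"; simp add: poly_action_def)

lemma update_eq_add_single:
  assumes "w \<notin> Poly_Mapping.keys f"
  shows "Poly_Mapping.update w c f = f + Poly_Mapping.single w c"
  using assms by (intro poly_mapping_eqI)
    (auto simp: lookup_update lookup_add lookup_single in_keys_iff when_def)

lemma poly_mapping_add_single_induct [case_names zero add_single]:
  assumes "P 0" "\<And>f w c. P f \<Longrightarrow> P (f + Poly_Mapping.single w c)"
  shows "P f"
  by (induction f rule: update_induct) (use assms in \<open>simp_all add: update_eq_add_single\<close>)

locale word_action =
  fixes \<gamma> :: "'n \<Rightarrow> ('i \<Rightarrow> complex) \<Rightarrow> ('i \<Rightarrow> complex)"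
  assumes add: "\<gamma> p (\<lambda>b. u b + v b) = (\<lambda>b. \<gamma> p u b + \<gamma> p v b)"
    and scale: "\<gamma> p (\<lambda>b. c * v b) = (\<lambda>b. c * \<gamma> p v b)"
begin

lemma foldr_add: "foldr \<gamma> l (\<lambda>b. u b + v b) = (\<lambda>b. foldr \<gamma> l u b + foldr \<gamma> l v b)"
  by (induction l) (simp_all add: add)

lemma foldr_scale: "foldr \<gamma> l (\<lambda>b. c * v b) = (\<lambda>b. c * foldr \<gamma> l v b)"
  by (induction l) (simp_all add: scale)

lemma foldr_zero: "foldr \<gamma> l (\<lambda>_. 0) = (\<lambda>_. 0)"
  using foldr_scale[of l 0] by simp

lemma poly_action_zero_right: "poly_action \<gamma> f (\<lambda>_. 0) = (\<lambda>_. 0)"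
  by (rule ext) (simp add: poly_action_def foldr_zero)

text \<open>On single words this is the composition law of \<open>foldr\<close>. Both factors are
  reduced to single words by additivity, which for the right factor uses linearity of the
  operators.\<close>

lemma poly_action_mult: "poly_action \<gamma> (f * g) v = poly_action \<gamma> f (poly_action \<gamma> g v)"
proof (induction f rule: poly_mapping_add_single_induct)
  case (add_single f w c)
  have "poly_action \<gamma> (Poly_Mapping.single w c * g) v =
      (\<lambda>b. c * foldr \<gamma> (letters w) (poly_action \<gamma> g v) b)"
  proof (induction g rule: poly_mapping_add_single_induct)
    case (add_single g w' c')
    then show ?case
      by (simp add: distrib_left poly_action_add mult_single poly_action_single plus_word_def
          foldr_add foldr_scale mult.assoc)
  qed (simp add: foldr_zero)
  then show ?case
    by (simp add: distrib_right poly_action_add poly_action_single add_single)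
qed simp

text \<open>Operators that satisfy the Clifford relations kill the generators of the ideal, and
  multiplicativity extends this to all two-sided multiples; so they act on the quotient.\<close>

lemma poly_action_clifford_ideal:
  assumes "\<And>p q v b. p \<noteq> q \<Longrightarrow> \<gamma> p (\<gamma> q v) b + \<gamma> q (\<gamma> p v) b = 0"
    and "\<And>p v b. \<gamma> p (\<gamma> p v) b + v b = 0"
    and "f \<in> clifford_ideal"
  shows "poly_action \<gamma> f v = (\<lambda>_. 0)"
  using assms(3)
proof (induction arbitrary: v)
  case (anticommute p q)
  then show ?case
    by (simp add: free_gen_def mult_single poly_action_add poly_action_single assms(1) plus_word_def)
next
  case (square p)
  then show ?case
    by (simp add: free_gen_def mult_single poly_action_add poly_action_single assms(2) plus_word_def
        zero_word_def flip: single_one)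
qed (simp_all add: poly_action_add poly_action_mult poly_action_zero_right)

end

section \<open>Linear independence through the Pauli representations\<close>

lemma UNIV_eq_3: "(UNIV :: 3 set) = {1, 2, 3}"
  by (rule card_subset_eq[symmetric]) simp_all

text \<open>The generators act by \<open>\<plusminus>\<surd>(-1)\<close> times the Pauli matrices; the two signs give the two
  inequivalent irreducible representations, in which \<open>e1 e2 e3\<close> acts as \<open>1\<close> and as \<open>-1\<close>.\<close>

definition pauli :: "complex \<Rightarrow> 3 \<Rightarrow> (bool \<Rightarrow> complex) \<Rightarrow> (bool \<Rightarrow> complex)"
  where "pauli s p v b =
    (if p = 1 then s * \<i> * v (\<not> b)
     else if p = 2 then s * (if b then v False else - v True)
     else s * \<i> * (if b then v True else - v False))"

lemma pauli_simps:
  "pauli s 1 v b = s * \<i> * v (\<not> b)"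
  "pauli s 2 v b = s * (if b then v False else - v True)"
  "pauli s 3 v b = s * \<i> * (if b then v True else - v False)"
  by (simp_all add: pauli_def)

interpretation pauli: word_action "pauli s"
  by standard (auto simp: pauli_def algebra_simps)

lemma poly_action_pauli_clifford_ideal:
  assumes "s * s = 1" "f \<in> clifford_ideal"
  shows "poly_action (pauli s) f v = (\<lambda>_. 0)"
proof (rule pauli.poly_action_clifford_ideal[OF _ _ assms(2)])
  have s: "s * (s * c) = c" for c
    using assms(1) by (simp flip: mult.assoc)
  have i: "\<i> * (\<i> * c) = - c" for c
    by (simp flip: mult.assoc)
  have si: "s * (\<i> * (s * c)) = \<i> * c" for c
    using s by (metis mult.left_commute)
  show "pauli s p (pauli s p v) b + v b = 0" for p v b
    by (auto simp: pauli_def s i si mult.assoc)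
  show "pauli s p (pauli s q v) b + pauli s q (pauli s p v) b = 0" if "p \<noteq> q" for p q v b
  proof -
    consider "p = 1" "q = 2" | "p = 1" "q = 3" | "p = 2" "q = 1" | "p = 2" "q = 3"
      | "p = 3" "q = 1" | "p = 3" "q = 2"
      using \<open>p \<noteq> q\<close> UNIV_eq_3 by (metis UNIV_I insertE singletonD)
    then show ?thesis
      by cases (cases b; simp add: pauli_simps s i si mult.assoc)+
  qed
qed

text \<open>The two representations together are faithful. For sign \<open>s\<close> the matrix
  entries determine \<open>c0 + s * c7\<close>, \<open>s * c3 - c4\<close>,
  \<open>s * c1 - c6\<close> and \<open>s * c2 + c5\<close>; taking both signs separates the
  coefficients.\<close>

lemma clifford3_coords_zero:
  fixes e1 e2 e3 :: "3 clifford"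
  assumes gens: "e1 = clifford_gen 1" "e2 = clifford_gen 2" "e3 = clifford_gen 3"
    and zero: "c0 *\<^sub>C 1 + c1 *\<^sub>C e1 + c2 *\<^sub>C e2 + c3 *\<^sub>C e3 + c4 *\<^sub>C (e1 * e2) + c5 *\<^sub>C (e1 * e3)
      + c6 *\<^sub>C (e2 * e3) + c7 *\<^sub>C (e1 * (e2 * e3)) = 0"
  shows "c0 = 0 \<and> c1 = 0 \<and> c2 = 0 \<and> c3 = 0 \<and> c4 = 0 \<and> c5 = 0 \<and> c6 = 0 \<and> c7 = 0"
proof -
  let ?f = "free_const c0 * 1 + free_const c1 * free_gen 1 + free_const c2 * free_gen 2
      + free_const c3 * free_gen 3 + free_const c4 * (free_gen 1 * free_gen 2)
      + free_const c5 * (free_gen 1 * free_gen 3) + free_const c6 * (free_gen 2 * free_gen 3)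
      + free_const c7 * (free_gen 1 * (free_gen 2 * free_gen 3)) :: 3 free_alg"
  have "clifford_rel ?f 0"
    using zero unfolding gens
    by (simp only: clifford_gen.abs_eq one_clifford.abs_eq times_clifford.abs_eq scaleC.abs_eq
        plus_clifford.abs_eq zero_clifford.abs_eq clifford.abs_eq_iff)
  then have ideal: "?f \<in> clifford_ideal"
    by (simp add: clifford_rel_def)
  have act: "poly_action (pauli s) ?f v b =
      c0 * v b + c1 * pauli s 1 v b + c2 * pauli s 2 v b + c3 * pauli s 3 v b
      + c4 * pauli s 1 (pauli s 2 v) b + c5 * pauli s 1 (pauli s 3 v) b
      + c6 * pauli s 2 (pauli s 3 v) b + c7 * pauli s 1 (pauli s 2 (pauli s 3 v)) b" for s v b
    by (simp add: free_gen_def free_const_def mult_single plus_word_def zero_word_def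
        poly_action_add poly_action_single flip: single_one)
  have eq: "c0 * v b + c1 * pauli s 1 v b + c2 * pauli s 2 v b + c3 * pauli s 3 v b
      + c4 * pauli s 1 (pauli s 2 v) b + c5 * pauli s 1 (pauli s 3 v) b
      + c6 * pauli s 2 (pauli s 3 v) b + c7 * pauli s 1 (pauli s 2 (pauli s 3 v)) b = 0"
    if "s * s = 1" for s v b
    using act[of s v b] poly_action_pauli_clifford_ideal[OF that ideal, of v] by simp
  have i: "\<i> * (\<i> * c) = - c" for c
    by (simp flip: mult.assoc)
  have *: "(c0 + s * c7) + \<i> * (s * c3 - c4) = 0 \<and> (c0 + s * c7) - \<i> * (s * c3 - c4) = 0
     \<and> \<i> * (s * c1 - c6) + (s * c2 + c5) = 0 \<and> \<i> * (s * c1 - c6) - (s * c2 + c5) = 0"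
    if s: "s * s = 1" for s
  proof -
    have 1: "s * (s * c) = c" for c
      using s by (simp flip: mult.assoc)
    have 2: "s * (\<i> * (s * c)) = \<i> * c" "s * (- c) = - (s * c)" for c
      using 1 by (metis mult.left_commute, simp)
    have 3: "s * (\<i> * s) = \<i>"
      using 1 by (metis mult.commute)
    \<comment> \<open>The two unit vectors, and both components of their images, give the four
      matrix entries.\<close>
    show ?thesis
    using  eq[OF s, of "\<lambda>b. if b then 1 else 0" True] eq[OF s, of "\<lambda>b. if b then 1 else 0" False]
      eq[OF s, of "\<lambda>b. if b then 0 else 1" True] eq[OF s, of "\<lambda>b. if b then 0 else 1" False]
    by (simp add: pauli_simps i 1 2 3 s mult.assoc) (simp add: algebra_simps)
  qed
  have sum_diff: "x = 0 \<and> y = 0" if "x + y = 0" "x - y = 0" for x y :: complex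
    using that by (simp add: add_eq_0_iff)
  have "c0 + s * c7 = 0 \<and> s * c3 - c4 = 0 \<and> s * c1 - c6 = 0 \<and> s * c2 + c5 = 0"
    if "s * s = 1" for s
    using *[OF that] sum_diff[of "c0 + s * c7" "\<i> * (s * c3 - c4)"]
      sum_diff[of "\<i> * (s * c1 - c6)" "s * c2 + c5"] by auto
  from this[of 1] this[of "- 1"]
  have "c0 + c7 = 0" "c0 - c7 = 0" "c5 + c2 = 0" "c5 - c2 = 0" "c3 - c4 = 0" "c3 + c4 = 0"
    "c1 - c6 = 0" "c1 + c6 = 0"
    by (auto simp: add_eq_0_iff)
  then show ?thesis
    using sum_diff by blast
qed

text \<open>Classes of words span the quotient, and each word arises from \<open>1\<close> by
  prepending letters. A spanning claim thus reduces to left multiplication by generators.\<close>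

lemma clifford_left_induct:
  fixes x :: "'n clifford"
  assumes "csubspace V" "1 \<in> V" "\<And>p x. x \<in> V \<Longrightarrow> clifford_gen p * x \<in> V"
  shows "x \<in> V"
proof (induction x)
  case (1 f)
  show ?case
  proof (induction f rule: poly_mapping_add_single_induct)
    case zero
    then show ?case
      using clifford_complex.subspace_0[OF assms(1)] by (simp add: zero_clifford.abs_eq)
  next
    case (add_single f w c)
    have "abs_clifford (Poly_Mapping.single (Word l) 1) \<in> V" for l :: "'n list"
    proof (induction l)
      case Nil
      then show ?case
        using assms(2) by (simp add: one_clifford.abs_eq flip: zero_word_def)
    next
      case (Cons p l)
      have "abs_clifford (Poly_Mapping.single (Word (p # l)) 1) =
          clifford_gen p * abs_clifford (Poly_Mapping.single (Word l) 1)"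
        by (simp add: clifford_gen.abs_eq times_clifford.abs_eq free_gen_def mult_single plus_word_def)
      then show ?case
        using assms(3) Cons by simp
    qed
    from clifford_complex.subspace_scale[OF assms(1) this[of "letters w"], of c]
    have "abs_clifford (Poly_Mapping.single w c) \<in> V"
      by (simp add: scaleC.abs_eq free_const_def mult_single)
    with add_single show ?case
      using clifford_complex.subspace_add[OF assms(1)] by (simp flip: plus_clifford.abs_eq)
  qed
qed

section \<open>Hyperplanes and linear functionals\<close>

context vector_space
begin

text \<open>Interpreting \<open>Vector_Spaces.linear\<close> for a functional would turn the simp rule \<open>scale_scale\<close> into
  reversed associativity of the product of scalars; hence these facts.\<close>

lemma linear_functional_simps:
  assumes "Vector_Spaces.linear scale (*) \<phi>"
  shows "\<phi> (x + y) = \<phi> x + \<phi> y" "\<phi> (x - y) = \<phi> x - \<phi> y" "\<phi> (- x) = - \<phi> x"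
    "\<phi> (scale c x) = c * \<phi> x" "\<phi> 0 = 0"
proof -
  interpret \<phi>: Vector_Spaces.linear scale "(*)" \<phi> by fact
  show "\<phi> (x + y) = \<phi> x + \<phi> y" "\<phi> (x - y) = \<phi> x - \<phi> y" "\<phi> (- x) = - \<phi> x"
    "\<phi> (scale c x) = c * \<phi> x" "\<phi> 0 = 0"
    by (rule \<phi>.add \<phi>.diff \<phi>.neg \<phi>.scale \<phi>.zero)+
qed

text \<open>If \<open>x - scale c v\<close> lies in \<open>span L\<close>, then
  \<open>\<phi> x = c * \<phi> v\<close>. This recognizes an explicit span as a kernel.\<close>

lemma kernel_in_span_insert:
  assumes "Vector_Spaces.linear scale (*) \<phi>" "\<phi> v \<noteq> 0" "\<And>x. x \<in> L \<Longrightarrow> \<phi> x = 0"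
  shows "{x \<in> span (insert v L). \<phi> x = 0} = span L"
proof -
  note \<phi>_simps = linear_functional_simps[OF assms(1)]
  have zero: "\<phi> x = 0" if "x \<in> span L" for x
    using that by (induction rule: span_induct_alt) (simp_all add: \<phi>_simps assms(3))
  show ?thesis
  proof (intro equalityI subsetI)
    fix x assume "x \<in> {x \<in> span (insert v L). \<phi> x = 0}"
    then obtain c where c: "x - scale c v \<in> span L" and x: "\<phi> x = 0"
      by (auto simp: span_breakdown_eq)
    have "c * \<phi> v = 0"
      using zero[OF c] x by (simp add: \<phi>_simps)
    then show "x \<in> span L"
      using c assms(2) by simp
  next
    fix x assume "x \<in> span L"
    then show "x \<in> {x \<in> span (insert v L). \<phi> x = 0}"
      using zero span_mono[of L "insert v L"] by auto
  qed
qed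

lemma ex_linear_functional:
  assumes "independent B"
  shows "\<exists>\<phi>. Vector_Spaces.linear scale (*) \<phi> \<and> (\<forall>b\<in>B. \<phi> b = f b)"
proof -
  interpret pair: vector_space_pair scale "(*) :: 'a \<Rightarrow> 'a \<Rightarrow> 'a"
    by standard (simp_all add: algebra_simps)
  show ?thesis
    using pair.linear_independent_extend[OF assms] .
qed

text \<open>A basis of \<open>h\<close> extended by some \<open>v\<close> of \<open>B\<close> is a
  basis of \<open>span B\<close>, and \<open>\<phi>\<close> is the coordinate at \<open>v\<close>.
  Working relative to \<open>span B\<close> covers the real span of the eight products inside the
  complex algebra.\<close>

lemma hyperplane_eq_kernel:
  assumes "subspace h" "h \<subseteq> span B" "independent B" "finite B" "card B = Suc (dim h)"
  obtains \<phi> where "Vector_Spaces.linear scale (*) \<phi>" "h = {x \<in> span B. \<phi> x = 0}" "\<exists>b\<in>B. \<phi> b \<noteq> 0"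
proof -
  obtain H where H: "H \<subseteq> h" "independent H" "h \<subseteq> span H" "card H = dim h"
    by (rule basis_exists)
  have H_span: "span H = h"
    using H(1,3) assms(1) span_minimal by blast
  have H_fin: "finite H"
    using independent_span_bound[OF assms(4) H(2)] H(1) assms(2) by auto
  have "\<exists>v\<in>B. v \<notin> span H"
  proof (rule ccontr)
    assume "\<not> (\<exists>v\<in>B. v \<notin> span H)"
    then have "card B \<le> card H"
      using independent_span_bound[OF H_fin assms(3)] by auto
    then show False using H(4) assms(5) by simp
  qed
  then obtain v where v: "v \<in> B" "v \<notin> span H" by blast
  then have v_H: "v \<notin> H" using span_base by blast
  have ind: "independent (insert v H)"
    using v(2) H(2) by (rule independent_insertI)
  have sub: "insert v H \<subseteq> span B"
    using v(1) H(1) assms(2) span_base by blast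
  \<comment> \<open>A further vector \<open>u\<close> would give \<open>card B + 1\<close>
    independent vectors in \<open>span B\<close>.\<close>
  have "B \<subseteq> span (insert v H)"
  proof (rule ccontr)
    assume "\<not> B \<subseteq> span (insert v H)"
    then obtain u where u: "u \<in> B" "u \<notin> span (insert v H)" by blast
    then have "u \<notin> insert v H" using span_base by blast
    moreover have "card (insert u (insert v H)) \<le> card B"
      using independent_span_bound[OF assms(4) independent_insertI[OF u(2) ind]] sub u(1) span_base
      by blast
    ultimately show False
      using v_H H_fin H(4) assms(5) by simp
  qed
  then have span_eq: "span (insert v H) = span B"
    using sub by (simp add: span_eq)
  obtain \<phi> where \<phi>: "Vector_Spaces.linear scale (*) \<phi>" "\<forall>b\<in>insert v H. \<phi> b = (if b = v then 1 else 0)"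
    using ex_linear_functional[OF ind, of "\<lambda>b. if b = v then 1 else 0"] by blast
  then have v1: "\<phi> v = 1" and H0: "\<And>x. x \<in> H \<Longrightarrow> \<phi> x = 0"
    using v_H by auto
  have kernel: "h = {x \<in> span B. \<phi> x = 0}"
    using kernel_in_span_insert[of \<phi> v H, OF \<phi>(1) _ H0] v1 span_eq H_span by simp
  moreover have "\<exists>b\<in>B. \<phi> b \<noteq> 0"
    using v(1) v1 by force
  ultimately show thesis using that \<phi>(1) by blast
qed

text \<open>Adding \<open>v\<close> raises the dimension by at most one, which gives the lower
  bound. Counting by the length of a list avoids a separate proof that the listed vectors are
  distinct.\<close>

lemma dim_hyperplane:
  assumes "independent B" "card B = Suc (length xs)" "span (insert v (set xs)) = span B"
  shows "dim (span (set xs)) = length xs"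
proof -
  obtain H where H: "H \<subseteq> set xs" "independent H" "set xs \<subseteq> span H" "card H = dim (set xs)"
    by (rule basis_exists)
  have "span B \<subseteq> span (insert v H)"
    unfolding assms(3)[symmetric]
    by (rule span_minimal) (use H(3) span_mono[of H "insert v H"] span_base in auto)
  then have "dim (span B) \<le> card (insert v H)"
    by (intro dim_le_card) (use H(1) finite_subset in auto)
  then have "Suc (length xs) \<le> Suc (dim (set xs))"
    using dim_eq_card_independent[OF assms(1)] assms(2) card_insert_le_m1[of "Suc (card H)" H v] H(4)
    by (auto split: if_splits simp: card_insert_if)
  moreover have "dim (set xs) \<le> length xs"
    using dim_le_card[of "set xs" "set xs"] span_superset[of "set xs"] card_length[of xs] by simp
  ultimately show ?thesis by simp
qed

end

section \<open>Multiplicatively closed hyperplanes\<close>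

text \<open>A general field of characteristic zero treats real and complex scalars at once. The
  eight products are assumed independent, but not spanning: their real span is a proper subset of
  the complex algebra.\<close>

locale clifford3 = vector_space scale
  for scale :: "'f::field_char_0 \<Rightarrow> 'a::{ring,monoid_mult} \<Rightarrow> 'a" (infixr \<open>*s\<close> 75) +
  fixes e1 e2 e3 :: 'a
  assumes scale_left: "(c *s x) * y = c *s (x * y)"
    and scale_right: "x * (c *s y) = c *s (x * y)"
    and squares: "e1 * e1 = - 1" "e2 * e2 = - 1" "e3 * e3 = - 1"
    and anticommute: "e2 * e1 = - (e1 * e2)" "e3 * e1 = - (e1 * e3)" "e3 * e2 = - (e2 * e3)"
    and coords_zero: "c0 *s 1 + c1 *s e1 + c2 *s e2 + c3 *s e3 + c4 *s (e1 * e2) + c5 *s (e1 * e3)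
      + c6 *s (e2 * e3) + c7 *s (e1 * (e2 * e3)) = 0 \<Longrightarrow>
      c0 = 0 \<and> c1 = 0 \<and> c2 = 0 \<and> c3 = 0 \<and> c4 = 0 \<and> c5 = 0 \<and> c6 = 0 \<and> c7 = 0"
begin

section \<open>Arithmetic of the eight products\<close>

abbreviation "i \<equiv> e1 * e2"
abbreviation "j \<equiv> e1 * e3"
abbreviation "k \<equiv> e2 * e3"
abbreviation "z \<equiv> e1 * (e2 * e3)"
abbreviation "basis \<equiv> {1, e1, e2, e3, i, j, k, z}"

text \<open>With a trailing factor \<open>x\<close> the relations also rewrite inside right-nested
  products, so that words are sorted up to sign.\<close>

lemma normalize:
  "e1 * (e1 * x) = - x" "e2 * (e2 * x) = - x" "e3 * (e3 * x) = - x"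
  "e2 * (e1 * x) = - (e1 * (e2 * x))" "e3 * (e1 * x) = - (e1 * (e3 * x))"
  "e3 * (e2 * x) = - (e2 * (e3 * x))"
  using squares anticommute by (simp_all flip: mult.assoc)

lemmas normal_form = mult.assoc squares anticommute normalize scale_left scale_right

text \<open>A generator passing through \<open>z\<close> crosses two different generators, and the
  two signs cancel. The locale says nothing about products with elements outside
  \<open>span basis\<close>.\<close>

lemma z_central: "z * x = x * z" if "x \<in> span basis"
  using that
  by (induction rule: span_induct_alt) (auto simp: normal_form algebra_simps)

lemma z_square: "z * (z * x) = x"
  by (simp add: normal_form)

lemma basis_distinct: "distinct [1, e1, e2, e3, i, j, k, z]"
proof -
  have *: "c0 *s 1 + c1 *s e1 + c2 *s e2 + c3 *s e3 + c4 *s (e1 * e2) + c5 *s (e1 * e3)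
      + c6 *s (e2 * e3) + c7 *s (e1 * (e2 * e3)) \<noteq> 0"
    if "(c0, c1, c2, c3, c4, c5, c6, c7) \<noteq> (0, 0, 0, 0, 0, 0, 0, 0)" for c0 c1 c2 c3 c4 c5 c6 c7
    using that coords_zero[of c0 c1 c2 c3 c4 c5 c6 c7] by auto
  \<comment> \<open>A coincidence would be a relation with coefficients \<open>1\<close> and
    \<open>-1\<close>; there is one instance for each of the 28 pairs.\<close>
  show ?thesis
    using *[of 1 "-1" 0 0 0 0 0 0] *[of 1 0 "-1" 0 0 0 0 0] *[of 1 0 0 "-1" 0 0 0 0]
      *[of 1 0 0 0 "-1" 0 0 0] *[of 1 0 0 0 0 "-1" 0 0] *[of 1 0 0 0 0 0 "-1" 0]
      *[of 1 0 0 0 0 0 0 "-1"] *[of 0 1 "-1" 0 0 0 0 0] *[of 0 1 0 "-1" 0 0 0 0]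
      *[of 0 1 0 0 "-1" 0 0 0] *[of 0 1 0 0 0 "-1" 0 0] *[of 0 1 0 0 0 0 "-1" 0]
      *[of 0 1 0 0 0 0 0 "-1"] *[of 0 0 1 "-1" 0 0 0 0] *[of 0 0 1 0 "-1" 0 0 0]
      *[of 0 0 1 0 0 "-1" 0 0] *[of 0 0 1 0 0 0 "-1" 0] *[of 0 0 1 0 0 0 0 "-1"]
      *[of 0 0 0 1 "-1" 0 0 0] *[of 0 0 0 1 0 "-1" 0 0] *[of 0 0 0 1 0 0 "-1" 0]
      *[of 0 0 0 1 0 0 0 "-1"] *[of 0 0 0 0 1 "-1" 0 0] *[of 0 0 0 0 1 0 "-1" 0]
      *[of 0 0 0 0 1 0 0 "-1"] *[of 0 0 0 0 0 1 "-1" 0] *[of 0 0 0 0 0 1 0 "-1"]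
      *[of 0 0 0 0 0 0 1 "-1"]
    by (simp add: scale_minus_left)
qed

lemma card_basis: "card basis = 8"
  using distinct_card[OF basis_distinct] by simp

lemma independent_basis: "independent basis"
proof
  assume "dependent basis"
  then obtain u where u: "\<exists>v\<in>basis. u v \<noteq> 0" "(\<Sum>v\<in>basis. u v *s v) = 0"
    using dependent_finite[of basis] by auto
  have "(\<Sum>v\<in>set [1, e1, e2, e3, i, j, k, z]. u v *s v) =
      sum_list (map (\<lambda>v. u v *s v) [1, e1, e2, e3, i, j, k, z])"
    by (rule sum_list_distinct_conv_sum_set[symmetric]) (rule basis_distinct)
  then have "u 1 *s 1 + u e1 *s e1 + u e2 *s e2 + u e3 *s e3 + u i *s i + u j *s j + u k *s k
      + u z *s z = 0"
    using u(2) by (simp add: add.assoc)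
  from coords_zero[OF this] u(1) show False
    by auto
qed

text \<open>Since \<open>z i = - e3\<close>, \<open>z j = e2\<close> and \<open>z k = - e1\<close>, the values prescribed at the generators express
  that \<open>\<phi> (z x) = s \<phi> x\<close>.\<close>

definition isotropic_functional :: "'f \<Rightarrow> ('a \<Rightarrow> 'f) \<Rightarrow> bool"
  where "isotropic_functional s \<phi> \<longleftrightarrow> s\<^sup>2 = 1 \<and> \<phi> 1 = 0 \<and> \<phi> z = 0
    \<and> \<phi> e1 = - s * \<phi> k \<and> \<phi> e2 = s * \<phi> j \<and> \<phi> e3 = - s * \<phi> i
    \<and> (\<phi> i)\<^sup>2 + (\<phi> j)\<^sup>2 + (\<phi> k)\<^sup>2 = 0 \<and> (\<phi> i, \<phi> j, \<phi> k) \<noteq> (0, 0, 0)"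

lemma isotropic_functional_if_kernel_mult_closed:
  assumes lin: "Vector_Spaces.linear (*s) (*) \<phi>"
    and nonzero: "\<exists>b\<in>basis. \<phi> b \<noteq> 0"
    and closed: "\<And>x y. \<lbrakk>x \<in> span basis; y \<in> span basis; \<phi> x = 0; \<phi> y = 0\<rbrakk> \<Longrightarrow> \<phi> (x * y) = 0"
  shows "\<exists>s. isotropic_functional s \<phi>"
proof -
  note \<phi>_simps = linear_functional_simps[OF lin]
  have base: "1 \<in> span basis" "e1 \<in> span basis" "e2 \<in> span basis" "e3 \<in> span basis"
    "i \<in> span basis" "j \<in> span basis" "k \<in> span basis" "z \<in> span basis"
    by (auto intro: span_base)
  note mem = base span_add span_diff span_neg span_scale
  have one: "\<phi> 1 = 0"
  proof (rule ccontr)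
    assume c: "\<phi> 1 \<noteq> 0"
    \<comment> \<open>The multiples of \<open>1\<close> move \<open>x\<close> and \<open>y\<close>
      into the kernel. Their squares force \<open>\<phi> i\<close> and \<open>\<phi> j\<close> to be
      nonzero, while \<open>x * y\<close> and \<open>y * x\<close> together force
      \<open>\<phi> i * \<phi> j = 0\<close>.\<close>
    define x y where "x = \<phi> 1 *s i - \<phi> i *s 1" and "y = \<phi> 1 *s j - \<phi> j *s 1"
    have xy: "x \<in> span basis" "y \<in> span basis" "\<phi> x = 0" "\<phi> y = 0"
      by (simp_all add: x_def y_def mem \<phi>_simps)
    have "\<phi> (x * y) = 0" "\<phi> (y * x) = 0" "\<phi> (x * x) = 0" "\<phi> (y * y) = 0"
      using closed xy by blast+
    moreover have "\<phi> (x * y) = \<phi> 1 * (\<phi> 1 * \<phi> k - \<phi> i * \<phi> j)"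
      "\<phi> (y * x) = \<phi> 1 * (- \<phi> 1 * \<phi> k - \<phi> i * \<phi> j)"
      "\<phi> (x * x) = \<phi> 1 * (- (\<phi> 1)\<^sup>2 - (\<phi> i)\<^sup>2)"
      "\<phi> (y * y) = \<phi> 1 * (- (\<phi> 1)\<^sup>2 - (\<phi> j)\<^sup>2)"
      by (simp_all add: x_def y_def left_diff_distrib right_diff_distrib normal_form \<phi>_simps,
          simp_all add: algebra_simps power2_eq_square)
    ultimately have "\<phi> 1 * \<phi> k - \<phi> i * \<phi> j = 0" "- \<phi> 1 * \<phi> k - \<phi> i * \<phi> j = 0"
      "- (\<phi> 1)\<^sup>2 - (\<phi> i)\<^sup>2 = 0" "- (\<phi> 1)\<^sup>2 - (\<phi> j)\<^sup>2 = 0"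
      using c by (metis mult_eq_0_iff)+
    then have "2 * (\<phi> i * \<phi> j) = 0" "\<phi> i \<noteq> 0" "\<phi> j \<noteq> 0"
      using c by (algebra, auto)
    then show False by simp
  qed
  have zz: "\<phi> z = 0"
  proof (rule ccontr)
    assume c: "\<phi> z \<noteq> 0"
    text \<open>Since \<open>z\<close> is central, \<open>\<phi>\<close> would be a trace, and so vanish on the generators, which are
      commutators; but the generators do not lie in a proper subalgebra.\<close>
    have trace: "\<phi> (x * y) = \<phi> (y * x)" if "x \<in> span basis" "y \<in> span basis" for x y
    proof -
      \<comment> \<open>Subtracting multiples of the central \<open>z\<close> moves both factors
        into the kernel and changes their commutator only by the factor
        \<open>\<phi> z * \<phi> z\<close>.\<close>
      let ?x = "\<phi> z *s x - \<phi> x *s z" and ?y = "\<phi> z *s y - \<phi> y *s z"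
      have "?x \<in> span basis" "?y \<in> span basis" "\<phi> ?x = 0" "\<phi> ?y = 0"
        using that by (simp_all add: mem \<phi>_simps)
      then have "\<phi> (?x * ?y) = \<phi> (?y * ?x)"
        using closed by simp
      then have "\<phi> z * \<phi> z * (\<phi> (x * y) - \<phi> (y * x)) = 0"
        using z_central[OF that(1)] z_central[OF that(2)]
        by (simp add: left_diff_distrib right_diff_distrib scale_left scale_right \<phi>_simps)
      then show ?thesis using c by simp
    qed
    have half: "a = 0" if "a = - a" for a :: 'f
    proof -
      have "a + a = 0" using that by (metis add.right_inverse)
      then show ?thesis by (simp flip: mult_2)
    qed
    \<comment> \<open>Each of the three pairs, multiplied in the two orders, gives a generator and
      its negative.\<close>
    have "\<phi> e1 = 0" "\<phi> e2 = 0" "\<phi> e3 = 0"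
      using trace[of i e2] trace[of i e1] trace[of j e1] base half
      by (simp_all add: normal_form \<phi>_simps)
    moreover from this have "\<phi> i = 0"
      using closed[of e1 e2] base by simp
    ultimately have "\<phi> z = 0"
      using closed[of i e3] base by (simp add: normal_form)
    with c show False by simp
  qed
  \<comment> \<open>As \<open>\<phi> z = 0\<close>, left multiplication by \<open>z\<close>
    preserves the kernel, so \<open>\<lambda>x. \<phi> (z * x)\<close> is a multiple of
    \<open>\<phi>\<close> on \<open>span basis\<close>.\<close>
  have proportional: "\<phi> y * \<phi> (z * x) = \<phi> x * \<phi> (z * y)" if "x \<in> span basis" "y \<in> span basis" for x y
    using closed[of z "\<phi> y *s x - \<phi> x *s y"] zz that
    by (simp add: mem \<phi>_simps right_diff_distrib scale_right)
  obtain y where y: "y \<in> basis" "\<phi> y \<noteq> 0"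
    using nonzero by blast
  define s where "s = \<phi> (z * y) / \<phi> y"
  have y_span: "y \<in> span basis"
    using y(1) by (rule span_base)
  have s: "\<phi> (z * x) = s * \<phi> x" if "x \<in> span basis" for x
    using proportional[OF that y_span] y(2) by (simp add: s_def field_simps)
  have "z * y \<in> span basis"
    using y(1) by (auto simp: normal_form mem)
  from s[OF this] s[OF y_span] have "\<phi> y = s * (s * \<phi> y)"
    by (simp add: z_square)
  then have s2: "s\<^sup>2 = 1"
    using y(2) by (simp add: power2_eq_square)
  have vals: "\<phi> e1 = - s * \<phi> k" "\<phi> e2 = s * \<phi> j" "\<phi> e3 = - s * \<phi> i"
    using s[OF base(7)] s[OF base(6)] s[OF base(5)]
    by (simp_all add: normal_form \<phi>_simps minus_equation_iff[of _ "s * _"])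
  have nz: "(\<phi> i, \<phi> j, \<phi> k) \<noteq> (0, 0, 0)"
    using y one zz vals by auto
  \<comment> \<open>These are the cross products of the vector
    \<open>n = (\<phi> i, \<phi> j, \<phi> k)\<close> with the coordinate axes, hence orthogonal to
    \<open>n\<close>. On each of their three cyclic products \<open>\<phi>\<close> takes a
    coordinate of \<open>n\<close> times \<open>?q\<close>.\<close>
  let ?x = "\<phi> j *s i - \<phi> i *s j" and ?y = "\<phi> k *s j - \<phi> j *s k" and ?w = "\<phi> i *s k - \<phi> k *s i"
  let ?q = "(\<phi> i)\<^sup>2 + (\<phi> j)\<^sup>2 + (\<phi> k)\<^sup>2"
  have "\<phi> (?x * ?y) = 0" "\<phi> (?y * ?w) = 0" "\<phi> (?w * ?x) = 0"
    by (intro closed; simp add: mem \<phi>_simps)+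
  moreover have "\<phi> (?x * ?y) = \<phi> j * ?q" "\<phi> (?y * ?w) = \<phi> k * ?q" "\<phi> (?w * ?x) = \<phi> i * ?q"
    by (simp_all add: left_diff_distrib right_diff_distrib normal_form \<phi>_simps one)
       (simp_all add: algebra_simps power2_eq_square)
  ultimately have "?q = 0"
    using nz by auto
  then show ?thesis
    unfolding isotropic_functional_def using s2 one zz vals nz by blast
qed

lemma ex_isotropic_functional:
  assumes "s\<^sup>2 = 1" "n1\<^sup>2 + n2\<^sup>2 + n3\<^sup>2 = 0" "(n1, n2, n3) \<noteq> (0, 0, 0)"
  obtains \<phi> where "Vector_Spaces.linear (*s) (*) \<phi>" "isotropic_functional s \<phi>"
    "\<phi> i = n1" "\<phi> j = n2" "\<phi> k = n3"
proof -
  \<comment> \<open>The default \<open>0\<close> is the value at \<open>1\<close> and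
    \<open>z\<close>; the values at the generators are dictated by
    \<open>\<phi> (z * x) = s * \<phi> x\<close>.\<close>
  define f where "f b = (if b = i then n1 else if b = j then n2 else if b = k then n3
    else if b = e1 then - s * n3 else if b = e2 then s * n2 else if b = e3 then - s * n1 else 0)" for b
  obtain \<phi> where \<phi>: "Vector_Spaces.linear (*s) (*) \<phi>" "\<forall>b\<in>basis. \<phi> b = f b"
    using ex_linear_functional[OF independent_basis, of f] by blast
  then have "\<phi> 1 = 0" "\<phi> z = 0" "\<phi> e1 = - s * n3" "\<phi> e2 = s * n2" "\<phi> e3 = - s * n1"
    "\<phi> i = n1" "\<phi> j = n2" "\<phi> k = n3"
    using basis_distinct by (auto simp: f_def)
  then show thesis
    using that[OF \<phi>(1)] assms unfolding isotropic_functional_def by simp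
qed

text \<open>The ideal generated by \<open>1 - s z\<close> is a matrix algebra annihilated by \<open>\<phi>\<close>, and modulo it the
  kernel of \<open>\<phi>\<close> is spanned by \<open>1\<close> and the quaternions orthogonal to the isotropic vector \<open>n\<close>. The
  cross product of two vectors orthogonal to \<open>n\<close> is a multiple of \<open>n\<close>, hence orthogonal to \<open>n\<close>.\<close>

lemma isotropic_kernel_mult_closed:
  assumes lin: "Vector_Spaces.linear (*s) (*) \<phi>"
    and iso: "isotropic_functional s \<phi>"
    and UNIV: "span basis = UNIV"
    and xy: "\<phi> x = 0" "\<phi> y = 0"
  shows "\<phi> (x * y) = 0"
proof -
  note \<phi>_simps = linear_functional_simps[OF lin]
  have s2: "s * s = 1" and vals: "\<phi> 1 = 0" "\<phi> z = 0" "\<phi> e1 = - s * \<phi> k" "\<phi> e2 = s * \<phi> j"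
    "\<phi> e3 = - s * \<phi> i" and q: "(\<phi> i)\<^sup>2 + (\<phi> j)\<^sup>2 + (\<phi> k)\<^sup>2 = 0"
    and nz: "\<phi> i \<noteq> 0 \<or> \<phi> j \<noteq> 0 \<or> \<phi> k \<noteq> 0"
    using iso by (auto simp: isotropic_functional_def power2_eq_square)
  have s_left: "s * (s * a) = a" for a
    using s2 by (simp flip: mult.assoc)
  define p where "p = 1 - s *s z"
  have p_central: "p * x = x * p" for x
    using z_central[of x] UNIV
    by (simp add: p_def left_diff_distrib right_diff_distrib scale_left scale_right)
  have \<phi>_z: "\<phi> (z * x) = s * \<phi> x" for x
  proof -
    have "x \<in> span basis" using UNIV by simp
    then show ?thesis
      by (induction rule: span_induct_alt)
        (auto simp: normal_form \<phi>_simps distrib_left vals s_left)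
  qed
  have \<phi>_p: "\<phi> (p * x) = 0" for x
    by (simp add: p_def left_diff_distrib scale_left \<phi>_simps \<phi>_z s_left)
  define quat where "quat a0 a1 a2 a3 = a0 *s 1 + a1 *s i + a2 *s j + a3 *s k" for a0 a1 a2 a3
  have decomp: "\<exists>a0 a1 a2 a3 u. x = quat a0 a1 a2 a3 + p * u" for x
  proof -
    define D where "D = {x. \<exists>a0 a1 a2 a3 u. x = quat a0 a1 a2 a3 + p * u}"
    have D_I: "quat a0 a1 a2 a3 + p * u \<in> D" for a0 a1 a2 a3 u
      unfolding D_def by blast
    have "subspace D"
    proof (rule subspaceI)
      show "0 \<in> D" using D_I[of 0 0 0 0 0] by (simp add: quat_def)
      fix x y c assume "x \<in> D"
      then obtain a0 a1 a2 a3 u where x: "x = quat a0 a1 a2 a3 + p * u" by (auto simp: D_def)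
      show "c *s x \<in> D"
        using D_I[of "c * a0" "c * a1" "c * a2" "c * a3" "c *s u"]
        by (simp add: x quat_def scale_right scale_right_distrib)
      assume "y \<in> D"
      then obtain b0 b1 b2 b3 v where y: "y = quat b0 b1 b2 b3 + p * v" by (auto simp: D_def)
      show "x + y \<in> D"
        using D_I[of "a0 + b0" "a1 + b1" "a2 + b2" "a3 + b3" "u + v"]
        by (simp add: x y quat_def scale_left_distrib distrib_left add_ac)
    qed
    \<comment> \<open>The first four instances are the quaternion units. The last four give
      \<open>z\<close>, \<open>e1\<close>, \<open>e2\<close> and \<open>e3\<close>: modulo multiples
      of \<open>p\<close>, the element \<open>z\<close> acts as the scalar \<open>s\<close>.\<close>
    moreover have "basis \<subseteq> D"
      using D_I[of 1 0 0 0 0] D_I[of 0 1 0 0 0] D_I[of 0 0 1 0 0] D_I[of 0 0 0 1 0]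
        D_I[of s 0 0 0 "- s *s 1"] D_I[of 0 0 0 "- s" "s *s k"] D_I[of 0 0 s 0 "- s *s j"]
        D_I[of 0 "- s" 0 0 "s *s i"]
      by (simp add: quat_def p_def left_diff_distrib normal_form s2 scale_right_diff_distrib
          scale_right_distrib)
    ultimately have "span basis \<subseteq> D" by (intro span_minimal)
    then have "x \<in> D" using UNIV by auto
    then show ?thesis unfolding D_def by blast
  qed
  obtain a0 a1 a2 a3 u where x: "x = quat a0 a1 a2 a3 + p * u" using decomp by blast
  obtain b0 b1 b2 b3 v where y: "y = quat b0 b1 b2 b3 + p * v" using decomp by blast
  let ?a = "quat a0 a1 a2 a3" and ?b = "quat b0 b1 b2 b3"
  have a: "a1 * \<phi> i + a2 * \<phi> j + a3 * \<phi> k = 0"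
    using xy(1) by (simp add: x \<phi>_simps \<phi>_p) (simp add: quat_def \<phi>_simps vals)
  have b: "b1 * \<phi> i + b2 * \<phi> j + b3 * \<phi> k = 0"
    using xy(2) by (simp add: y \<phi>_simps \<phi>_p) (simp add: quat_def \<phi>_simps vals)
  \<comment> \<open>Since \<open>p\<close> is central, all terms containing it collect into one
    multiple of \<open>p\<close>, which \<open>\<phi>\<close> annihilates.\<close>
  have "x * y = ?a * ?b + p * (u * y + ?a * v)"
    by (simp add: x y distrib_left distrib_right mult.assoc)
       (metis mult.assoc p_central)
  then have "\<phi> (x * y) = \<phi> (?a * ?b)"
    by (simp add: \<phi>_simps \<phi>_p)
  \<comment> \<open>This is quaternion multiplication, with the dot product of the vector parts lost
    because \<open>\<phi> 1 = 0\<close>. The last summand is the triple product of both vector parts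
    with the isotropic vector.\<close>
  also have "\<dots> = a0 * (b1 * \<phi> i + b2 * \<phi> j + b3 * \<phi> k) + b0 * (a1 * \<phi> i + a2 * \<phi> j + a3 * \<phi> k)
      + ((a2 * b3 - a3 * b2) * \<phi> i + (a3 * b1 - a1 * b3) * \<phi> j + (a1 * b2 - a2 * b1) * \<phi> k)"
    by (simp add: quat_def distrib_left distrib_right normal_form \<phi>_simps vals)
       (simp add: algebra_simps)
  also have "(a2 * b3 - a3 * b2) * \<phi> i + (a3 * b1 - a1 * b3) * \<phi> j + (a1 * b2 - a2 * b1) * \<phi> k = 0"
    (is "?t = 0")
  proof -
    \<comment> \<open>Multiplied by a coordinate of the isotropic vector, \<open>?t\<close> lies in
      the ideal generated by the two orthogonality relations and the isotropy relation; some
      coordinate is nonzero.\<close>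
    have "\<phi> i * ?t = 0" "\<phi> j * ?t = 0" "\<phi> k * ?t = 0"
      using a b q by algebra+
    then show ?thesis using nz by auto
  qed
  finally show ?thesis
    by (simp add: a b)
qed

text \<open>This is the kernel of an isotropic functional scaled to \<open>\<phi> k = 1\<close>,
  with \<open>m1 = \<phi> i\<close> and \<open>m2 = \<phi> j\<close>: each basis product
  \<open>b\<close> other than \<open>k\<close> is corrected to
  \<open>b - \<phi> b *s k\<close>.\<close>

definition hyper_k :: "'f \<Rightarrow> 'f \<Rightarrow> 'f \<Rightarrow> 'a set"
  where "hyper_k s m1 m2 = span {1, e1 + s *s k, e2 - (s * m2) *s k, e3 + (s * m1) *s k,
    i - m1 *s k, j - m2 *s k, z}"

text \<open>The remaining case \<open>\<phi> k = 0\<close>, scaled to \<open>\<phi> j = 1\<close>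
  with \<open>m = \<phi> i\<close>; corrections are now multiples of \<open>j\<close>.\<close>

definition hyper_j :: "'f \<Rightarrow> 'f \<Rightarrow> 'a set"
  where "hyper_j s m = span {1, e1, e2 - s *s j, e3 + (s * m) *s j, i - m *s j, k, z}"

lemma basis_subset_spanI:
  assumes "v \<in> span S" "1 \<in> span S" "z \<in> span S"
    "e1 + c1 *s v \<in> span S" "e2 + c2 *s v \<in> span S" "e3 + c3 *s v \<in> span S"
    "i + c4 *s v \<in> span S" "j + c5 *s v \<in> span S" "k + c6 *s v \<in> span S"
  shows "basis \<subseteq> span S"
proof -
  have "x \<in> span S" if "x + c *s v \<in> span S" for x c
    using that assms(1) by (simp add: span_add_eq2 span_scale)
  then show ?thesis
    using assms by blast
qed

lemma hyper_k_insert: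
  "span (insert k {1, e1 + s *s k, e2 - (s * m2) *s k, e3 + (s * m1) *s k,
    i - m1 *s k, j - m2 *s k, z}) = span basis" (is "span ?L = _")
proof -
  have "basis \<subseteq> span ?L"
    by (rule basis_subset_spanI[where v = k and ?c1.0 = s and ?c2.0 = "- (s * m2)" and ?c3.0 = "s * m1"
        and ?c4.0 = "- m1" and ?c5.0 = "- m2" and ?c6.0 = 0]) (auto intro: span_base)
  moreover have "?L \<subseteq> span basis"
    by (auto intro!: span_add span_diff span_scale intro: span_base)
  ultimately show ?thesis by (simp only: span_eq)
qed

lemma hyper_j_insert:
  "span (insert j {1, e1, e2 - s *s j, e3 + (s * m) *s j, i - m *s j, k, z}) = span basis"
  (is "span ?L = _")
proof -
  have "basis \<subseteq> span ?L"
    by (rule basis_subset_spanI[where v = j and ?c1.0 = 0 and ?c2.0 = "- s" and ?c3.0 = "s * m"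
        and ?c4.0 = "- m" and ?c5.0 = 0 and ?c6.0 = 0]) (auto intro: span_base)
  moreover have "?L \<subseteq> span basis"
    by (auto intro!: span_add span_diff span_scale intro: span_base)
  ultimately show ?thesis by (simp only: span_eq)
qed

text \<open>Scaling a functional keeps its kernel, so only the ratios to \<open>\<phi> k\<close>
  enter.\<close>

lemma kernel_eq_hyper_k:
  assumes lin: "Vector_Spaces.linear (*s) (*) \<phi>" and iso: "isotropic_functional s \<phi>"
    and "\<phi> k \<noteq> 0" "\<phi> i = m1 * \<phi> k" "\<phi> j = m2 * \<phi> k"
  shows "{x \<in> span basis. \<phi> x = 0} = hyper_k s m1 m2"
  unfolding hyper_k_def hyper_k_insert[of s m2 m1, symmetric]
  by (rule kernel_in_span_insert[OF lin])
    (use assms in \<open>auto simp: linear_functional_simps[OF lin] isotropic_functional_def\<close>)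

lemma kernel_eq_hyper_j:
  assumes lin: "Vector_Spaces.linear (*s) (*) \<phi>" and iso: "isotropic_functional s \<phi>"
    and "\<phi> k = 0" "\<phi> j \<noteq> 0" "\<phi> i = m * \<phi> j"
  shows "{x \<in> span basis. \<phi> x = 0} = hyper_j s m"
  unfolding hyper_j_def hyper_j_insert[of s m, symmetric]
  by (rule kernel_in_span_insert[OF lin])
    (use assms in \<open>auto simp: linear_functional_simps[OF lin] isotropic_functional_def\<close>)

lemma dim_hyper_k: "dim (hyper_k s m1 m2) = 7"
  using dim_hyperplane[OF independent_basis,
      of "[1, e1 + s *s k, e2 - (s * m2) *s k, e3 + (s * m1) *s k, i - m1 *s k, j - m2 *s k, z]" k]
    hyper_k_insert[of s m2 m1] card_basis
  by (simp add: hyper_k_def)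

lemma dim_hyper_j: "dim (hyper_j s m) = 7"
  using dim_hyperplane[OF independent_basis,
      of "[1, e1, e2 - s *s j, e3 + (s * m) *s j, i - m *s j, k, z]" j]
    hyper_j_insert[of s m] card_basis
  by (simp add: hyper_j_def)

text \<open>The isotropic vector is scaled at \<open>\<phi> k\<close> or, if that vanishes, at
  \<open>\<phi> j\<close>. Being relative to \<open>span basis\<close>, the result serves both
  scalar fields.\<close>

lemma hyperplane_subalgebra_cases:
  assumes "subspace h" "h \<subseteq> span basis" "dim h = 7" "\<And>x y. \<lbrakk>x \<in> h; y \<in> h\<rbrakk> \<Longrightarrow> x * y \<in> h"
  shows "(\<exists>s m1 m2. s\<^sup>2 = 1 \<and> m1\<^sup>2 + m2\<^sup>2 + 1 = 0 \<and> h = hyper_k s m1 m2)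
    \<or> (\<exists>s m. s\<^sup>2 = 1 \<and> m\<^sup>2 + 1 = 0 \<and> h = hyper_j s m)"
proof -
  obtain \<phi> where lin: "Vector_Spaces.linear (*s) (*) \<phi>" and h: "h = {x \<in> span basis. \<phi> x = 0}"
    and nz: "\<exists>b\<in>basis. \<phi> b \<noteq> 0"
    by (rule hyperplane_eq_kernel[OF assms(1,2) independent_basis])
      (use card_basis assms(3) in auto)
  have "\<phi> (x * y) = 0" if "x \<in> span basis" "y \<in> span basis" "\<phi> x = 0" "\<phi> y = 0" for x y
    using assms(4)[of x y] that by (auto simp: h)
  then obtain s where iso: "isotropic_functional s \<phi>"
    using isotropic_functional_if_kernel_mult_closed[OF lin nz] by blast
  then have s: "s\<^sup>2 = 1" and q: "(\<phi> i)\<^sup>2 + (\<phi> j)\<^sup>2 + (\<phi> k)\<^sup>2 = 0"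
    and nz: "(\<phi> i, \<phi> j, \<phi> k) \<noteq> (0, 0, 0)"
    unfolding isotropic_functional_def by blast+
  show ?thesis
  proof (cases "\<phi> k = 0")
    case False
    define m1 m2 where "m1 = \<phi> i / \<phi> k" and "m2 = \<phi> j / \<phi> k"
    have "h = hyper_k s m1 m2"
      unfolding h by (rule kernel_eq_hyper_k[OF lin iso]) (use False in \<open>simp_all add: m1_def m2_def\<close>)
    moreover have "m1\<^sup>2 + m2\<^sup>2 + 1 = 0"
      using q False by (simp add: m1_def m2_def power_divide field_simps)
    ultimately show ?thesis using s by blast
  next
    case True
    \<comment> \<open>If \<open>\<phi> j\<close> vanished as well, isotropy would give
      \<open>\<phi> i = 0\<close>, against \<open>nz\<close>.\<close>
    then have j: "\<phi> j \<noteq> 0" using q nz by auto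
    define m where "m = \<phi> i / \<phi> j"
    have "h = hyper_j s m"
      unfolding h by (rule kernel_eq_hyper_j[OF lin iso]) (use True j in \<open>simp_all add: m_def\<close>)
    moreover have "m\<^sup>2 + 1 = 0"
      using q True j by (simp add: m_def power_divide field_simps)
    ultimately show ?thesis using s by blast
  qed
qed

lemma hyper_k_mult_closed:
  assumes "span basis = UNIV" "s\<^sup>2 = 1" "m1\<^sup>2 + m2\<^sup>2 + 1 = 0" "x \<in> hyper_k s m1 m2" "y \<in> hyper_k s m1 m2"
  shows "x * y \<in> hyper_k s m1 m2"
proof -
  \<comment> \<open>The assumed equation says that the vector \<open>(m1, m2, 1)\<close> is
    isotropic.\<close>
  obtain \<phi> where \<phi>: "Vector_Spaces.linear (*s) (*) \<phi>" "isotropic_functional s \<phi>"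
    "\<phi> i = m1" "\<phi> j = m2" "\<phi> k = 1"
    using ex_isotropic_functional[of s m1 m2 1] assms(2,3) by auto
  then have "hyper_k s m1 m2 = {x \<in> span basis. \<phi> x = 0}"
    by (intro kernel_eq_hyper_k[symmetric]) auto
  then have "hyper_k s m1 m2 = {x. \<phi> x = 0}"
    using assms(1) by simp
  then show ?thesis
    using isotropic_kernel_mult_closed[OF \<phi>(1,2) assms(1)] assms(4,5) by simp
qed

lemma hyper_j_mult_closed:
  assumes "span basis = UNIV" "s\<^sup>2 = 1" "m\<^sup>2 + 1 = 0" "x \<in> hyper_j s m" "y \<in> hyper_j s m"
  shows "x * y \<in> hyper_j s m"
proof -
  obtain \<phi> where \<phi>: "Vector_Spaces.linear (*s) (*) \<phi>" "isotropic_functional s \<phi>"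
    "\<phi> i = m" "\<phi> j = 1" "\<phi> k = 0"
    using ex_isotropic_functional[of s m 1 0] assms(2,3) by auto
  then have "hyper_j s m = {x \<in> span basis. \<phi> x = 0}"
    by (intro kernel_eq_hyper_j[symmetric]) auto
  then have "hyper_j s m = {x. \<phi> x = 0}"
    using assms(1) by simp
  then show ?thesis
    using isotropic_kernel_mult_closed[OF \<phi>(1,2) assms(1)] assms(4,5) by simp
qed

end

section \<open>The subalgebras of codimension one\<close>

lemma clifford3_complex:
  "clifford3 scaleC (clifford_gen 1 :: 3 clifford) (clifford_gen 2) (clifford_gen 3)"
proof -
  interpret vector_space "scaleC :: complex \<Rightarrow> 3 clifford \<Rightarrow> 3 clifford"
    by (rule scaleC_vector_space)
  show ?thesis
    by unfold_locales
      (fact clifford_gen_square scaleC_mult_left scaleC_mult_right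
        | rule clifford_gen_anticommute; simp; fail
        | rule clifford3_coords_zero; simp)+
qed

text \<open>A real relation among the eight products is a complex relation with real
  coefficients.\<close>

lemma clifford3_real:
  "clifford3 scaleR (clifford_gen 1 :: 3 clifford) (clifford_gen 2) (clifford_gen 3)"
proof -
  interpret c: clifford3 scaleC "clifford_gen 1 :: 3 clifford" "clifford_gen 2" "clifford_gen 3"
    by (rule clifford3_complex)
  show ?thesis
  proof (unfold_locales)
    fix c0 c1 c2 c3 c4 c5 c6 c7 :: real
    assume "c0 *\<^sub>R 1 + c1 *\<^sub>R clifford_gen 1 + c2 *\<^sub>R clifford_gen 2 + c3 *\<^sub>R clifford_gen 3
      + c4 *\<^sub>R (clifford_gen 1 * clifford_gen 2) + c5 *\<^sub>R (clifford_gen 1 * clifford_gen 3)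
      + c6 *\<^sub>R (clifford_gen 2 * clifford_gen 3)
      + c7 *\<^sub>R (clifford_gen 1 * (clifford_gen 2 * clifford_gen 3)) = (0 :: 3 clifford)"
    from c.coords_zero[OF this[unfolded scaleR_clifford_def]]
    show "c0 = 0 \<and> c1 = 0 \<and> c2 = 0 \<and> c3 = 0 \<and> c4 = 0 \<and> c5 = 0 \<and> c6 = 0 \<and> c7 = 0"
      by simp
  qed (simp_all add: scaleR_right_distrib scaleR_left_distrib c.squares c.anticommute)
qed

section \<open>Classification over the complex numbers and nonexistence over the reals\<close>

context
  fixes e1 e2 e3 :: "3 clifford"
  assumes gens: "e1 = clifford_gen 1" "e2 = clifford_gen 2" "e3 = clifford_gen 3"
begin

interpretation c: clifford3 scaleC e1 e2 e3
  rewrites "module.span scaleC = (cspan :: 3 clifford set \<Rightarrow> _)"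
    and "module.subspace scaleC = (csubspace :: 3 clifford set \<Rightarrow> _)"
    and "vector_space.dim scaleC = (cdim :: 3 clifford set \<Rightarrow> _)"
  using clifford3_complex by (simp_all add: gens cspan_def csubspace_def cdim_def)

text \<open>A generator times one of the eight products is again one of them up to sign, so their
  span contains \<open>1\<close> and is closed under left multiplication by generators.\<close>

lemma cspan_basis: "cspan {1, e1, e2, e3, e1 * e2, e1 * e3, e2 * e3, e1 * (e2 * e3)} = UNIV"
  (is "cspan ?B = _")
proof -
  have base: "b \<in> ?B \<Longrightarrow> b \<in> cspan ?B" for b
    by (rule clifford_complex.span_base)
  have mult: "e * b \<in> cspan ?B" if "e \<in> {e1, e2, e3}" "b \<in> ?B" for e b
    using that
    by (elim insertE emptyE; simp only: c.normal_form minus_minus mult_1_right mult_minus_right;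
        intro clifford_complex.span_neg base; simp)
  have gen: "clifford_gen p * x \<in> cspan ?B" if "x \<in> cspan ?B" for p x
  proof -
    have "clifford_gen p \<in> {e1, e2, e3}"
      using UNIV_eq_3 gens by (metis UNIV_I insert_iff singletonD)
    then have gen_base: "clifford_gen p * b \<in> cspan ?B" if "b \<in> ?B" for b
      using mult that by blast
    show ?thesis
      using that
      by (induction rule: clifford_complex.span_induct_alt)
        (simp_all add: gen_base distrib_left scaleC_mult_right clifford_complex.span_zero
          clifford_complex.span_add clifford_complex.span_scale del: insert_iff)
  qed
  have "x \<in> cspan ?B" for x
    by (rule clifford_left_induct[OF clifford_complex.subspace_span base gen]) simp_all
  then show ?thesis by blast
qed

lemma complex_subalgebra_dim_7_iff:
  "complex_subalgebra h \<and> cdim h = 7 \<longleftrightarrow>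
    (\<exists>s m1 m2. s\<^sup>2 = 1 \<and> m1\<^sup>2 + m2\<^sup>2 + 1 = 0 \<and> h = c.hyper_k s m1 m2)
    \<or> (\<exists>s m. s\<^sup>2 = 1 \<and> m\<^sup>2 + 1 = 0 \<and> h = c.hyper_j s m)" (is "?L \<longleftrightarrow> ?R")
proof
  assume ?L
  then show ?R
    unfolding complex_subalgebra_def
    by (intro c.hyperplane_subalgebra_cases) (auto simp: cspan_basis)
next
  assume ?R
  then show ?L
  proof (elim disjE exE conjE)
    fix s m1 m2 assume *: "s\<^sup>2 = 1" "m1\<^sup>2 + m2\<^sup>2 + 1 = 0" "h = c.hyper_k s m1 m2"
    have "csubspace h"
      unfolding *(3) c.hyper_k_def by (rule clifford_complex.subspace_span)
    then show ?L
      using c.hyper_k_mult_closed[OF cspan_basis *(1,2)] c.dim_hyper_k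
      by (simp add: complex_subalgebra_def *(3))
  next
    fix s m assume *: "s\<^sup>2 = 1" "m\<^sup>2 + 1 = 0" "h = c.hyper_j s m"
    have "csubspace h"
      unfolding *(3) c.hyper_j_def by (rule clifford_complex.subspace_span)
    then show ?L
      using c.hyper_j_mult_closed[OF cspan_basis *(1,2)] c.dim_hyper_j
      by (simp add: complex_subalgebra_def *(3))
  qed
qed

lemma no_real_subalgebra_dim_7:
  assumes "real_subalgebra h" "h \<subseteq> span {1, e1, e2, e3, e1 * e2, e1 * e3, e2 * e3, e1 * (e2 * e3)}"
  shows "dim h \<noteq> 7"
proof
  interpret r: clifford3 scaleR e1 e2 e3
    rewrites "module.span scaleR = (span :: 3 clifford set \<Rightarrow> _)"
      and "module.subspace scaleR = (subspace :: 3 clifford set \<Rightarrow> _)"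
      and "vector_space.dim scaleR = (dim :: 3 clifford set \<Rightarrow> _)"
    using clifford3_real by (simp_all add: gens span_raw_def subspace_raw_def dim_raw_def)
  assume "dim h = 7"
  then have "(\<exists>s m1 m2. s\<^sup>2 = 1 \<and> m1\<^sup>2 + m2\<^sup>2 + 1 = 0 \<and> h = r.hyper_k s m1 m2)
    \<or> (\<exists>s m. s\<^sup>2 = 1 \<and> m\<^sup>2 + 1 = 0 \<and> h = r.hyper_j s m)"
    using assms unfolding real_subalgebra_def
    by (intro r.hyperplane_subalgebra_cases) auto
  moreover have "m1\<^sup>2 + m2\<^sup>2 + 1 \<noteq> 0" "m1\<^sup>2 + 1 \<noteq> 0" for m1 m2 :: real
    by (smt (verit) zero_le_power2)+
  ultimately show False by blast
qed

lemma complex_subalgebras_dim_7: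
  assumes sqrtC: "\<And>w. (sqrtC w)\<^sup>2 = w"
  shows "{h. complex_subalgebra h \<and> cdim h = 7} =
      (\<Union>a. {c.hyper_k 1 (sqrtC (- 1 - a\<^sup>2)) (- a)})
    \<union> (\<Union>a. {c.hyper_k 1 (- sqrtC (- 1 - a\<^sup>2)) (- a)})
    \<union> (\<Union>a. {c.hyper_k (- 1) (- sqrtC (- 1 - a\<^sup>2)) a})
    \<union> (\<Union>a. {c.hyper_k (- 1) (sqrtC (- 1 - a\<^sup>2)) a})
    \<union> {c.hyper_j (- 1) (- \<i>), c.hyper_j (- 1) \<i>, c.hyper_j 1 \<i>, c.hyper_j 1 (- \<i>)}"
    (is "?L = ?R")
proof (intro equalityI subsetI)
  fix h assume "h \<in> ?L"
  then have "complex_subalgebra h \<and> cdim h = 7"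
    by simp
  then consider (k) s m1 m2 where "s\<^sup>2 = 1" "m1\<^sup>2 + m2\<^sup>2 + 1 = 0" "h = c.hyper_k s m1 m2"
    | (j) s m where "s\<^sup>2 = 1" "m\<^sup>2 + 1 = 0" "h = c.hyper_j s m"
    unfolding complex_subalgebra_dim_7_iff by blast
  then show "h \<in> ?R"
  proof cases
    case k
    have "m1\<^sup>2 = (m1\<^sup>2 + m2\<^sup>2 + 1) - 1 - m2\<^sup>2"
      by simp
    then have "m1\<^sup>2 = (sqrtC (- 1 - m2\<^sup>2))\<^sup>2"
      unfolding k(2) sqrtC by simp
    \<comment> \<open>\<open>sqrtC\<close> selects one of the two roots, so both signs occur; they
      lead to different families.\<close>
    then have m1: "m1 = sqrtC (- 1 - m2\<^sup>2) \<or> m1 = - sqrtC (- 1 - m2\<^sup>2)"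
      by (simp add: power2_eq_iff)
    from k(1) have "s = 1 \<or> s = - 1"
      by (simp add: power2_eq_1_iff)
    then show ?thesis
    proof
      assume s: "s = 1"
      \<comment> \<open>In \<open>hyper_k\<close> the coefficient of \<open>k\<close> next to
        \<open>e2\<close> is \<open>- (s * m2)\<close>, which is the parameter \<open>a\<close> of
        the family; for \<open>s = - 1\<close> it is \<open>m2\<close> itself.\<close>
      define a where "a = - m2"
      have "h = c.hyper_k 1 (sqrtC (- 1 - a\<^sup>2)) (- a) \<or> h = c.hyper_k 1 (- sqrtC (- 1 - a\<^sup>2)) (- a)"
        using m1 by (auto simp: k(3) s a_def)
      then show ?thesis
        by (elim disjE) blast+
    next
      assume s: "s = - 1"
      have "h = c.hyper_k (- 1) (sqrtC (- 1 - m2\<^sup>2)) m2 \<or> h = c.hyper_k (- 1) (- sqrtC (- 1 - m2\<^sup>2)) m2"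
        using m1 by (auto simp: k(3) s)
      then show ?thesis
        by (elim disjE) blast+
    qed
  next
    case j
    have "m\<^sup>2 = \<i>\<^sup>2"
      using j(2) by (simp add: eq_neg_iff_add_eq_0)
    then have "m = \<i> \<or> m = - \<i>"
      by (simp only: power2_eq_iff)
    moreover from j(1) have "s = 1 \<or> s = - 1"
      by (simp add: power2_eq_1_iff)
    ultimately show ?thesis
      using j(3) by blast
  qed
next
  have k: "c.hyper_k s m1 m2 \<in> ?L" if "s\<^sup>2 = 1" "m1\<^sup>2 = - 1 - m2\<^sup>2" for s m1 m2
  proof -
    have "m1\<^sup>2 + m2\<^sup>2 + 1 = 0" using that(2) by simp
    then have "complex_subalgebra (c.hyper_k s m1 m2) \<and> cdim (c.hyper_k s m1 m2) = 7"
      using that(1) unfolding complex_subalgebra_dim_7_iff by blast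
    then show ?thesis by simp
  qed
  have j: "c.hyper_j s m \<in> ?L" if "s\<^sup>2 = 1" "m\<^sup>2 = - 1" for s m
  proof -
    have "m\<^sup>2 + 1 = 0" using that(2) by simp
    then have "complex_subalgebra (c.hyper_j s m) \<and> cdim (c.hyper_j s m) = 7"
      using that(1) unfolding complex_subalgebra_dim_7_iff by blast
    then show ?thesis by simp
  qed
  fix h assume "h \<in> ?R"
  then show "h \<in> ?L"
    by (elim UnE UN_E insertE emptyE) (simp only:, (rule k | rule j); simp add: sqrtC)+
qed

lemmas hyper_eq_cspan = c.hyper_k_def c.hyper_j_def

end

theorem mainTheorem1:
  fixes sqrtC :: "complex \<Rightarrow> complex"
    and e1 e2 e3 i j k z :: "3 clifford"
  assumes sqrtC: "\<And>w. (sqrtC w)\<^sup>2 = w"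
    and gens: "e1 = clifford_gen 1" "e2 = clifford_gen 2" "e3 = clifford_gen 3"
    and prods: "i = e1 * e2" "j = e1 * e3" "k = e2 * e3" "z = e1 * e2 * e3"
  shows "{h. complex_subalgebra h \<and> cdim h = 7} =
      (\<Union>a. {cspan {1, e1 + k, e2 + a *\<^sub>C k, e3 + sqrtC (-1 - a\<^sup>2) *\<^sub>C k,
                    i - sqrtC (-1 - a\<^sup>2) *\<^sub>C k, j + a *\<^sub>C k, z}})
    \<union> (\<Union>a. {cspan {1, e1 + k, e2 + a *\<^sub>C k, e3 - sqrtC (-1 - a\<^sup>2) *\<^sub>C k,
                    i + sqrtC (-1 - a\<^sup>2) *\<^sub>C k, j + a *\<^sub>C k, z}})
    \<union> (\<Union>a. {cspan {1, e1 - k, e2 + a *\<^sub>C k, e3 + sqrtC (-1 - a\<^sup>2) *\<^sub>C k,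
                    i + sqrtC (-1 - a\<^sup>2) *\<^sub>C k, j - a *\<^sub>C k, z}})
    \<union> (\<Union>a. {cspan {1, e1 - k, e2 + a *\<^sub>C k, e3 - sqrtC (-1 - a\<^sup>2) *\<^sub>C k,
                    i - sqrtC (-1 - a\<^sup>2) *\<^sub>C k, j - a *\<^sub>C k, z}})
    \<union> {cspan {1, e1, e2 + j, e3 + \<i> *\<^sub>C j, i + \<i> *\<^sub>C j, k, z},
       cspan {1, e1, e2 + j, e3 - \<i> *\<^sub>C j, i - \<i> *\<^sub>C j, k, z},
       cspan {1, e1, e2 - j, e3 + \<i> *\<^sub>C j, i - \<i> *\<^sub>C j, k, z},
       cspan {1, e1, e2 - j, e3 - \<i> *\<^sub>C j, i + \<i> *\<^sub>C j, k, z}}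
    \<and> \<not> (\<exists>h \<subseteq> span {1, e1, e2, e3, i, j, k, z}. real_subalgebra h \<and> dim h = 7)"
proof
  have z: "z = e1 * (e2 * e3)"
    by (simp add: prods(4) mult.assoc)
  show "\<not> (\<exists>h \<subseteq> span {1, e1, e2, e3, i, j, k, z}. real_subalgebra h \<and> dim h = 7)"
    using no_real_subalgebra_dim_7[OF gens] unfolding z prods(1-3) by blast
  note hyper_eq = hyper_eq_cspan[OF gens, folded z prods(1-3)]
  \<comment> \<open>Negative parameters of \<open>hyper_k\<close> and \<open>hyper_j\<close> produce
    double signs; these equations restore the displayed ones.\<close>
  have minus: "x - (- c) *\<^sub>C y = x + c *\<^sub>C y" "x + (- c) *\<^sub>C y = x - c *\<^sub>C y" for x y :: "3 clifford" and c
    by simp_all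
  show "{h. complex_subalgebra h \<and> cdim h = 7} =
      (\<Union>a. {cspan {1, e1 + k, e2 + a *\<^sub>C k, e3 + sqrtC (-1 - a\<^sup>2) *\<^sub>C k,
                    i - sqrtC (-1 - a\<^sup>2) *\<^sub>C k, j + a *\<^sub>C k, z}})
    \<union> (\<Union>a. {cspan {1, e1 + k, e2 + a *\<^sub>C k, e3 - sqrtC (-1 - a\<^sup>2) *\<^sub>C k,
                    i + sqrtC (-1 - a\<^sup>2) *\<^sub>C k, j + a *\<^sub>C k, z}})
    \<union> (\<Union>a. {cspan {1, e1 - k, e2 + a *\<^sub>C k, e3 + sqrtC (-1 - a\<^sup>2) *\<^sub>C k,
                    i + sqrtC (-1 - a\<^sup>2) *\<^sub>C k, j - a *\<^sub>C k, z}})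
    \<union> (\<Union>a. {cspan {1, e1 - k, e2 + a *\<^sub>C k, e3 - sqrtC (-1 - a\<^sup>2) *\<^sub>C k,
                    i - sqrtC (-1 - a\<^sup>2) *\<^sub>C k, j - a *\<^sub>C k, z}})
    \<union> {cspan {1, e1, e2 + j, e3 + \<i> *\<^sub>C j, i + \<i> *\<^sub>C j, k, z},
       cspan {1, e1, e2 + j, e3 - \<i> *\<^sub>C j, i - \<i> *\<^sub>C j, k, z},
       cspan {1, e1, e2 - j, e3 + \<i> *\<^sub>C j, i - \<i> *\<^sub>C j, k, z},
       cspan {1, e1, e2 - j, e3 - \<i> *\<^sub>C j, i + \<i> *\<^sub>C j, k, z}}"
    using complex_subalgebras_dim_7[OF gens sqrtC] unfolding hyper_eq
    by (simp only: minus mult_1_left mult_minus1 minus_minus clifford_complex.scale_one)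
qed

end
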